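(* Let $\alpha>-\frac12$. (i) For $\lambda,x\in\mathbb{R}_q$, $V_{\alpha,q}\big(e(-i\lambda\,\cdot\,;q^2)\big)(x)=\psi_{-\lambda}^{\alpha,q}(x)$. (ii) $V_{\alpha,q}$ satisfies the transmutation relation: for all $f\in\mathcal{E}_q(\mathbb{R}_q)$, $$\Lambda_{\alpha,q}V_{\alpha,q}(f)=V_{\alpha,q}(\partial_qf),\qquad V_{\alpha,q}(f)(0)=f(0).$$
   Context: Standing assumptions: $q\in(0,1)$ and $\frac{\log(1-q)}{\log q}\in 2\mathbb{Z}$. Functions are complex-valued. $\mathbb{R}_q=\{\pm q^n: n\in\mathbb{Z}\}$; $f_e,f_o$ are the even and odd parts of $f$. Notation: $(a;q)_\infty=\prod_{k\ge0}(1-aq^k)$, $[x]_q=\frac{1-q^x}{1-q}$, $[n]_q!=\prod_{k=1}^n[k]_q$, $\Gamma_{q^2}(x)=\frac{(q^2;q^2)_\infty}{(q^{2x};q^2)_\infty}(1-q^2)^{1-x}$. $\int_{-1}^1h(t)d_qt=(1-q)\sum_{n\ge0}q^n[h(q^n)+h(-q^n)]$. For $z\neq0$, $\partial_q f(z)=\frac{f(q^{-1}z)+f(-q^{-1}z)-f(qz)+f(-qz)-2f(-z)}{2(1-q)z}$. $\mathcal{E}_q(\mathbb{R}_q)$ is the space of functions $f$ on $\mathbb{R}_q$ such that for all $n\in\mathbb{N}$, $a\ge0$, $\sup\{|\partial_q^kf(x)|:0\le k\le n,\ x\in[-a,a]\cap\mathbb{R}_q\}<\infty$ and $\lim_{x\to0,x\in\mathbb{R}_q}\partial_q^nf(x)$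 exists. For such $f$, $f(0)$ denotes $\lim_{x\to0,x\in\mathbb{R}_q}f(x)$. $q$-Dunkl operator: $\Lambda_{\alpha,q}(f)(x)=\partial_q[H_{\alpha,q}(f)](x)+[2\alpha+1]_q\frac{f(x)-f(-x)}{2x}$, where $H_{\alpha,q}(f)=f_e+q^{2\alpha+1}f_o$. $C(\alpha;q^2)=(1+q)\frac{\Gamma_{q^2}(\alpha+1)}{\Gamma_{q^2}(\frac12)\Gamma_{q^2}(\alpha+\frac12)}$, $W_\alpha(t;q^2)=\frac{(t^2q^2;q^2)_\infty}{(t^2q^{2\alpha+1};q^2)_\infty}$. $q$-Dunkl intertwining operator: for $f\in\mathcal{E}_q(\mathbb{R}_q)$, $x\in\mathbb{R}_q$, $V_{\alpha,q}(f)(x)=\frac{C(\alpha;q^2)}{2}\int_{-1}^1W_\alpha(t;q^2)(1+t)f(xt)d_qt$. $\cos(x;q^2)=\sum_{n\ge0}(-1)^nq^{n(n+1)}\frac{x^{2n}}{[2n]_q!}$, $\sin(x;q^2)=\sum_{n\ge0}(-1)^nq^{n(n+1)}\frac{x^{2n+1}}{[2n+1]_q!}$, $e(z;q^2)=\cos(-iz;q^2)+i\sin(-iz;q^2)$. $j_\alpha(x;q^2)=\sum_{n\ge0}(-1)^n\frac{\Gamma_{q^2}(\alpha+1)q^{n(n+1)}}{\Gamma_{q^2}(\alpha+n+1)\Gamma_{q^2}(n+1)}\left(\frac{x}{1+q}\right)^{2n}$, $\psi_\lambda^{\alpha,q}(x)=j_\alpha(\lambda x;q^2)+\frac{i\lambda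 x}{[2\alpha+2]_q}j_{\alpha+1}(\lambda x;q^2)$. *)

theory Defs
  imports "HOL-Analysis.Analysis"
begin

text \<open>
  Functions on \<open>\<real>\<^sub>q\<close> are represented by total functions of type \<open>real \<Rightarrow> complex\<close>. Since \<open>\<real>\<^sub>q\<close> is
  closed under multiplication by \<open>-1\<close> and by integer powers of \<open>q\<close>, all the operators below,
  evaluated at points of \<open>\<real>\<^sub>q\<close>, only depend on the values of their argument on \<open>\<real>\<^sub>q\<close>.
\<close>

definition Rq :: "real \<Rightarrow> real set" where
  "Rq q = {x. \<exists>n::int. x = q powi n \<or> x = - (q powi n)}"

definition qpoch_inf :: "real \<Rightarrow> real \<Rightarrow> real" where
  "qpoch_inf a q = (\<Prod>k. 1 - a * q ^ k)"

definition qbracket :: "real \<Rightarrow> real \<Rightarrow> real" where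
  "qbracket q x = (1 - q powr x) / (1 - q)"

definition qfact :: "real \<Rightarrow> nat \<Rightarrow> real" where
  "qfact q n = (\<Prod>k=1..n. qbracket q (real k))"

text \<open>The \<open>q\<close>-Gamma function with base \<open>q\<^sup>2\<close>, as a function of \<open>q\<close>.\<close>

definition qGamma2 :: "real \<Rightarrow> real \<Rightarrow> real" where
  "qGamma2 q x =
     qpoch_inf (q\<^sup>2) (q\<^sup>2) / qpoch_inf (q powr (2 * x)) (q\<^sup>2) * (1 - q\<^sup>2) powr (1 - x)"

text \<open>The Jackson integral over \<open>[-1, 1]\<close>.\<close>

definition qintegral :: "real \<Rightarrow> (real \<Rightarrow> complex) \<Rightarrow> complex" where
  "qintegral q h =
     of_real (1 - q) * (\<Sum>n. of_real (q ^ n) * (h (q ^ n) + h (- (q ^ n))))"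

definition dq :: "real \<Rightarrow> (real \<Rightarrow> complex) \<Rightarrow> real \<Rightarrow> complex" where
  "dq q f z =
     (f (inverse q * z) + f (- (inverse q * z)) - f (q * z) + f (- (q * z)) - 2 * f (- z))
       / of_real (2 * (1 - q) * z)"

definition Eq_space :: "real \<Rightarrow> (real \<Rightarrow> complex) set" where
  "Eq_space q = {f. \<forall>n::nat.
     (\<forall>a\<ge>0. bdd_above {cmod ((dq q ^^ k) f x) | k x. k \<le> n \<and> x \<in> {-a..a} \<inter> Rq q}) \<and>
     (\<exists>L. ((dq q ^^ n) f \<longlongrightarrow> L) (at 0 within Rq q))}"

text \<open>
  The value at \<open>0\<close> of a function on \<open>\<real>\<^sub>q\<close> (note \<open>0 \<notin> \<real>\<^sub>q\<close>); meaningful whenever the limit exists,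
  in particular for all members of \<open>Eq_space q\<close> (take \<open>n = 0\<close> there). The value \<open>f 0\<close> of the
  representing total function is irrelevant.
\<close>

definition value0 :: "real \<Rightarrow> (real \<Rightarrow> complex) \<Rightarrow> complex" where
  "value0 q f = Lim (at 0 within Rq q) f"

definition even_part :: "(real \<Rightarrow> complex) \<Rightarrow> real \<Rightarrow> complex" where
  "even_part f x = (f x + f (- x)) / 2"

definition odd_part :: "(real \<Rightarrow> complex) \<Rightarrow> real \<Rightarrow> complex" where
  "odd_part f x = (f x - f (- x)) / 2"

definition H_op :: "real \<Rightarrow> real \<Rightarrow> (real \<Rightarrow> complex) \<Rightarrow> real \<Rightarrow> complex" where
  "H_op \<alpha> q f x = even_part f x + of_real (q powr (2 * \<alpha> + 1)) * odd_part f x"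

definition qDunkl :: "real \<Rightarrow> real \<Rightarrow> (real \<Rightarrow> complex) \<Rightarrow> real \<Rightarrow> complex" where
  "qDunkl \<alpha> q f x =
     dq q (H_op \<alpha> q f) x
       + of_real (qbracket q (2 * \<alpha> + 1)) * ((f x - f (- x)) / of_real (2 * x))"

definition C_const :: "real \<Rightarrow> real \<Rightarrow> real" where
  "C_const \<alpha> q = (1 + q) * (qGamma2 q (\<alpha> + 1) / (qGamma2 q (1/2) * qGamma2 q (\<alpha> + 1/2)))"

definition W_weight :: "real \<Rightarrow> real \<Rightarrow> real \<Rightarrow> real" where
  "W_weight \<alpha> q t =
     qpoch_inf (t\<^sup>2 * q\<^sup>2) (q\<^sup>2) / qpoch_inf (t\<^sup>2 * q powr (2 * \<alpha> + 1)) (q\<^sup>2)"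

definition V_op :: "real \<Rightarrow> real \<Rightarrow> (real \<Rightarrow> complex) \<Rightarrow> real \<Rightarrow> complex" where
  "V_op \<alpha> q f x =
     of_real (C_const \<alpha> q / 2)
       * qintegral q (\<lambda>t. of_real (W_weight \<alpha> q t * (1 + t)) * f (x * t))"

text \<open>\<open>qcos q z\<close>, \<open>qsin q z\<close>, \<open>qexp q z\<close> and \<open>j_fun \<alpha> q z\<close> are the functions with base \<open>q\<^sup>2\<close>.\<close>

definition qcos :: "real \<Rightarrow> complex \<Rightarrow> complex" where
  "qcos q z =
     (\<Sum>n. (-1) ^ n * of_real (q ^ (n * (n + 1))) * z ^ (2 * n) / of_real (qfact q (2 * n)))"

definition qsin :: "real \<Rightarrow> complex \<Rightarrow> complex" where
  "qsin q z =
     (\<Sum>n. (-1) ^ n * of_real (q ^ (n * (n + 1))) * z ^ (2 * n + 1) / of_real (qfact q (2 * n + 1)))"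

definition qexp :: "real \<Rightarrow> complex \<Rightarrow> complex" where
  "qexp q z = qcos q (- \<i> * z) + \<i> * qsin q (- \<i> * z)"

definition j_fun :: "real \<Rightarrow> real \<Rightarrow> complex \<Rightarrow> complex" where
  "j_fun \<alpha> q z =
     (\<Sum>n. (-1) ^ n
        * of_real (qGamma2 q (\<alpha> + 1) * q ^ (n * (n + 1))
                    / (qGamma2 q (\<alpha> + real n + 1) * qGamma2 q (real n + 1)))
        * (z / of_real (1 + q)) ^ (2 * n))"

definition psi :: "real \<Rightarrow> real \<Rightarrow> real \<Rightarrow> real \<Rightarrow> complex" where
  "psi \<alpha> q \<mu> x =
     j_fun \<alpha> q (of_real (\<mu> * x))
       + \<i> * of_real (\<mu> * x) / of_real (qbracket q (2 * \<alpha> + 2)) * j_fun (\<alpha> + 1) q (of_real (\<mu> * x))"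

end

theory Submission
  imports Defs
begin

text \<open>
  Put \<open>w\<^sub>k = W\<^sub>\<alpha>(q\<^sup>k; q\<^sup>2)\<close> and \<open>b = q\<^bsup>2\<alpha>+1\<^esup>\<close>. Everything rests on the Pearson-type recurrence
  \<open>w\<^bsub>k+1\<^esub> (1 - q\<^bsup>2k+2\<^esup>) = w\<^sub>k (1 - b q\<^bsup>2k\<^esup>)\<close>. It gives a first-order recurrence for the even moments
  of the weight, hence their values, and integrating the power series of cosine and sine termwise
  turns them into those of \<open>j\<^sub>\<alpha>\<close> and \<open>j\<^bsub>\<alpha>+1\<^esub>\<close>. For the transmutation relation split \<open>f\<close> into its even
  and odd parts: \<open>\<partial>\<^sub>q f(z)\<close> is \<open>(f\<^sub>e(z/q) - f\<^sub>e(z) + f\<^sub>o(z) - f\<^sub>o(qz)) / ((1-q)z)\<close>, so that for \<open>f\<^sub>e\<close> both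
  sides agree term by term, while for \<open>f\<^sub>o\<close> the recurrence makes their difference telescope.
\<close>

section \<open>Infinite \<open>q\<close>-Pochhammer symbols and the \<open>q\<^sup>2\<close>-Gamma function\<close>

lemma qpoch_convergent:
  fixes a p :: real
  assumes "0 \<le> p" "p < 1"
  shows "convergent_prod (\<lambda>k. 1 - a * p ^ k)"
proof -
  have "summable (\<lambda>k. norm ((1 - a * p ^ k) - 1))"
    using assms by (simp add: abs_mult power_abs summable_mult summable_geometric)
  then show ?thesis
    by (intro abs_convergent_prod_imp_convergent_prod summable_imp_abs_convergent_prod)
qed

lemma qpoch_factor_pos:
  fixes a p :: real
  assumes "0 \<le> p" "p < 1" "0 \<le> a" "a < 1"
  shows "0 < 1 - a * p ^ k"
proof -
  have "a * p ^ k \<le> a * 1" using assms by (intro mult_left_mono power_le_one) auto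
  then show ?thesis using assms by linarith
qed

lemma qpoch_inf_pos:
  assumes "0 \<le> p" "p < 1" "0 \<le> a" "a < 1"
  shows "0 < qpoch_inf a p"
  unfolding qpoch_inf_def
  by (intro less_0_prodinf qpoch_convergent qpoch_factor_pos assms)

lemma qpoch_inf_split:
  assumes "0 \<le> p" "p < 1" "0 \<le> a" "a < 1"
  shows "qpoch_inf a p = (1 - a) * qpoch_inf (a * p) p"
proof -
  have "(\<Prod>k. 1 - a * p ^ Suc k) = qpoch_inf a p / (1 - a * p ^ 0)"
    unfolding qpoch_inf_def using assms by (intro prodinf_split_head qpoch_convergent) auto
  then show ?thesis using assms by (simp add: qpoch_inf_def mult.assoc field_simps)
qed

text \<open>The factors are non-negative and decrease in the parameter. This gives the bound on the
  weights that does not depend on the node.\<close>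

lemma qpoch_inf_antimono:
  assumes "0 \<le> p" "p < 1" "0 \<le> a" "a \<le> a'" "a' < 1"
  shows "qpoch_inf a' p \<le> qpoch_inf a p"
  unfolding qpoch_inf_def
proof (rule prodinf_le[OF convergent_prod_has_prod convergent_prod_has_prod])
  show "0 \<le> 1 - a' * p ^ n \<and> 1 - a' * p ^ n \<le> 1 - a * p ^ n" for n
    using qpoch_factor_pos[of p a' n] assms by (auto intro: mult_right_mono)
qed (use assms qpoch_convergent in auto)

lemma qpoch_inf_le_one:
  assumes "0 \<le> p" "p < 1" "0 \<le> a" "a < 1"
  shows "qpoch_inf a p \<le> 1"
  using qpoch_inf_antimono[of p 0 a] assms by (simp add: qpoch_inf_def)

lemma qpoch_inf_LIMSEQ:
  assumes "0 \<le> p" "p < 1"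
  shows "(\<lambda>n. \<Prod>k<n. 1 - a * p ^ k) \<longlonglongrightarrow> qpoch_inf a p"
  using convergent_prod_LIMSEQ[OF qpoch_convergent[OF assms]]
  unfolding qpoch_inf_def lessThan_Suc_atMost[symmetric] by (rule LIMSEQ_imp_Suc)

lemma powr_less_one_base:
  fixes q :: real
  assumes "0 < q" "q < 1" "0 < x"
  shows "q powr x < 1"
  using assms powr_less_mono'[of q 0 x] by simp

lemma qGamma2_pos:
  assumes "0 < q" "q < 1" "0 < x"
  shows "0 < qGamma2 q x"
proof -
  have "q\<^sup>2 < 1" using assms by (simp add: power_less_one_iff)
  moreover have "q powr (2 * x) < 1" using assms by (simp add: powr_less_one_base)
  ultimately show ?thesis unfolding qGamma2_def
    using assms by (intro mult_pos_pos divide_pos_pos qpoch_inf_pos) simp_all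
qed

text \<open>Passing from \<open>x\<close> to \<open>x + 1\<close> strips the first factor off the
  Pochhammer symbol in the denominator.\<close>

lemma qGamma2_add_one:
  assumes "0 < q" "q < 1" "0 < x"
  shows "qGamma2 q (x + 1) = (1 - q powr (2 * x)) / (1 - q\<^sup>2) * qGamma2 q x"
proof -
  have q2: "q\<^sup>2 < 1" using assms by (simp add: power_less_one_iff)
  have x: "q powr (2 * x) < 1" using assms by (simp add: powr_less_one_base)
  have shift: "q powr (2 * (x + 1)) = q powr (2 * x) * q\<^sup>2"
    using assms by (simp add: powr_add algebra_simps)
  have x': "q powr (2 * (x + 1)) < 1" using assms by (intro powr_less_one_base) auto
  have split: "qpoch_inf (q powr (2 * x)) (q\<^sup>2)
      = (1 - q powr (2 * x)) * qpoch_inf (q powr (2 * (x + 1))) (q\<^sup>2)"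
    unfolding shift using x q2 by (intro qpoch_inf_split) auto
  have pos: "0 < qpoch_inf (q powr (2 * (x + 1))) (q\<^sup>2)"
    using x' q2 by (intro qpoch_inf_pos) auto
  have "(1 - q\<^sup>2) powr (1 - (x + 1)) = (1 - q\<^sup>2) powr (1 - x) / (1 - q\<^sup>2)"
    using q2 by (simp add: powr_minus_divide powr_diff)
  moreover have "Q / P * (R / D) = u / D * (Q / (u * P) * R)" if "u \<noteq> 0" for P Q R D u :: real
    using that by simp
  ultimately show ?thesis
    unfolding qGamma2_def split using x by simp
qed

lemma qGamma2_one:
  assumes "0 < q" "q < 1"
  shows "qGamma2 q 1 = 1"
proof -
  have "q\<^sup>2 < 1" using assms by (simp add: power_less_one_iff)
  then have "0 < qpoch_inf (q\<^sup>2) (q\<^sup>2)" by (intro qpoch_inf_pos) auto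
  then show ?thesis using assms \<open>q\<^sup>2 < 1\<close> by (simp add: qGamma2_def)
qed

section \<open>q-brackets and q-factorials\<close>

lemma qfact_Suc: "qfact q (Suc n) = qfact q n * qbracket q (real (Suc n))"
  by (simp add: qfact_def)

lemma qbracket_nat:
  assumes "0 < q"
  shows "qbracket q (real n) = (1 - q ^ n) / (1 - q)"
  using assms by (simp add: qbracket_def powr_realpow)

text \<open>Every bracket of a positive integer is at least 1, so factorials in a denominator may be
  dropped in comparison tests.\<close>

lemma qfact_ge_one:
  assumes "0 < q" "q < 1"
  shows "1 \<le> qfact q n"
  unfolding qfact_def
proof (rule prod_ge_1)
  fix k assume "k \<in> {1..n}"
  then have "q ^ k \<le> q ^ 1" using assms by (intro power_decreasing) auto
  then show "1 \<le> qbracket q (real k)" using assms by (simp add: qbracket_nat)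
qed

section \<open>The discrete weight and its moments\<close>

locale q_dunkl =
  fixes q \<alpha> :: real
  assumes q_pos: "0 < q" and q_less_one: "q < 1" and alpha: "\<alpha> > - 1 / 2"
begin

abbreviation b :: real where "b \<equiv> q powr (2 * \<alpha> + 1)"

definition w :: "nat \<Rightarrow> real" where "w k = W_weight \<alpha> q (q ^ k)"

text \<open>Up to the factor \<open>1 - q\<close>, this is the Jackson integral of
  \<open>t^(2n)\<close> against the weight over [0, 1].\<close>

definition moment :: "nat \<Rightarrow> real" where "moment n = (\<Sum>k. w k * q ^ k * (q ^ (2 * k)) ^ n)"

lemma q2_less_one: "q\<^sup>2 < 1"
  using q_pos q_less_one by (simp add: power_less_one_iff)

lemma q_power_less_one: "0 < n \<Longrightarrow> q ^ n < 1"
  using q_pos q_less_one by (simp add: power_less_one_iff)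

lemma b_pos: "0 < b"
  using q_pos by simp

lemma b_less_one: "b < 1"
  using q_pos q_less_one alpha by (intro powr_less_one_base) auto

lemma b_power_less_one: "b * q ^ n < 1"
  using qpoch_factor_pos[of q b n] b_less_one q_pos q_less_one by simp

lemma w_eq: "w k = qpoch_inf (q ^ (2 * k + 2)) (q\<^sup>2) / qpoch_inf (b * q ^ (2 * k)) (q\<^sup>2)"
proof -
  have "(q ^ k)\<^sup>2 = q ^ (2 * k)" by (simp add: power_mult[symmetric] mult.commute)
  moreover have "q ^ (2 * k + 2) = q ^ (2 * k) * q\<^sup>2" by (rule power_add)
  ultimately show ?thesis unfolding w_def W_weight_def by (simp only: mult.commute)
qed

lemma w_pos: "0 < w k"
  unfolding w_eq using q_pos q2_less_one b_power_less_one[of "2 * k"] q_power_less_one[of "2 * k + 2"]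
  by (intro divide_pos_pos qpoch_inf_pos) simp_all

text \<open>The numerator is at most 1 and the denominator is smallest at \<open>k = 0\<close>. The
  bound provides both summability and control of boundary terms.\<close>

lemma w_le: "w k \<le> 1 / qpoch_inf b (q\<^sup>2)"
  unfolding w_eq
proof (rule frac_le)
  show "qpoch_inf (q ^ (2 * k + 2)) (q\<^sup>2) \<le> 1"
    using q_pos q2_less_one q_power_less_one[of "2 * k + 2"] by (intro qpoch_inf_le_one) simp_all
  show "0 < qpoch_inf b (q\<^sup>2)" using q2_less_one b_less_one by (intro qpoch_inf_pos) auto
  have "b * q ^ (2 * k) \<le> b * 1"
    using q_pos q_less_one b_pos by (intro mult_left_mono power_le_one) auto
  then show "qpoch_inf b (q\<^sup>2) \<le> qpoch_inf (b * q ^ (2 * k)) (q\<^sup>2)"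
    using q_pos q2_less_one b_less_one by (intro qpoch_inf_antimono) auto
qed simp

text \<open>When \<open>k\<close> grows by one, the symbols in the numerator and in the denominator
  each shed their first factor.\<close>

lemma w_rec: "w (Suc k) * (1 - q ^ (2 * Suc k)) = w k * (1 - b * q ^ (2 * k))"
proof -
  have lt: "q ^ (2 * k + 2) < 1" by (rule q_power_less_one) simp
  have num: "qpoch_inf (q ^ (2 * k + 2)) (q\<^sup>2)
      = (1 - q ^ (2 * k + 2)) * qpoch_inf (q ^ (2 * Suc k + 2)) (q\<^sup>2)"
    using qpoch_inf_split[of "q\<^sup>2" "q ^ (2 * k + 2)"] q_pos q2_less_one lt
    by (simp add: power_add power2_eq_square mult_ac)
  have den: "qpoch_inf (b * q ^ (2 * k)) (q\<^sup>2)
      = (1 - b * q ^ (2 * k)) * qpoch_inf (b * q ^ (2 * Suc k)) (q\<^sup>2)"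
    using qpoch_inf_split[of "q\<^sup>2" "b * q ^ (2 * k)"] q_pos q2_less_one b_power_less_one[of "2 * k"]
    by (simp add: power_add power2_eq_square mult_ac)
  have "0 < qpoch_inf (b * q ^ (2 * Suc k)) (q\<^sup>2)"
    using q_pos q2_less_one b_power_less_one[of "2 * Suc k"] by (intro qpoch_inf_pos) auto
  then show ?thesis
    using b_power_less_one[of "2 * k"] unfolding w_eq num den by (simp add: field_simps)
qed

lemma summable_weight: "summable (\<lambda>k. w k * q ^ k)"
proof (rule summable_comparison_test')
  show "summable (\<lambda>k. 1 / qpoch_inf b (q\<^sup>2) * q ^ k)"
    using q_pos q_less_one by (intro summable_mult summable_geometric) auto
  show "norm (w k * q ^ k) \<le> 1 / qpoch_inf b (q\<^sup>2) * q ^ k" for k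
    using w_pos[of k] w_le[of k] q_pos by (auto simp: abs_mult simp del: times_divide_eq_left intro!: mult_right_mono)
qed

lemma summable_weight_bounded:
  fixes g :: "nat \<Rightarrow> 'a::{real_normed_algebra_1,banach}"
  assumes "\<And>k. norm (g k) \<le> B"
  shows "summable (\<lambda>k. of_real (w k * q ^ k) * g k)"
proof (rule summable_comparison_test')
  show "summable (\<lambda>k. B * (w k * q ^ k))" using summable_weight by (rule summable_mult)
  show "norm (of_real (w k * q ^ k) * g k) \<le> B * (w k * q ^ k)" for k
  proof -
    have "norm (of_real (w k * q ^ k) * g k) \<le> (w k * q ^ k) * norm (g k)"
      using norm_mult_ineq[of "of_real (w k * q ^ k)" "g k"] w_pos[of k] q_pos
      by (simp only: norm_of_real abs_of_pos mult_pos_pos zero_less_power)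
    also have "\<dots> \<le> (w k * q ^ k) * B"
      using assms w_pos[of k] q_pos by (intro mult_left_mono) auto
    finally show ?thesis by (simp add: mult_ac)
  qed
qed

section \<open>Even moments of the weight and the normalising constant\<close>

lemma summable_moment: "summable (\<lambda>k. w k * q ^ k * (q ^ (2 * k)) ^ n)"
  using summable_weight_bounded[of "\<lambda>k. (q ^ (2 * k)) ^ n" 1] q_pos q_less_one
  by (simp add: power_le_one)

text \<open>The difference of two consecutive moments carries the factor \<open>1 - q^(2k)\<close>
  in its \<open>k\<close>-th term. After an index shift \<open>w_rec\<close> trades it for
  \<open>1 - b q^(2k)\<close>, which again yields a combination of the same two moments.\<close>

lemma moment_rec: "moment n * (1 - q ^ (2 * n + 1)) = moment (Suc n) * (1 - b * q ^ (2 * n + 1))"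
proof -
  define t where "t n k = w k * q ^ k * (q ^ (2 * k)) ^ n" for n k
  have sm: "summable (t n)" for n unfolding t_def by (rule summable_moment)
  have "moment n - moment (Suc n) = (\<Sum>k. t n k - t (Suc n) k)"
    unfolding moment_def t_def[symmetric] by (rule suminf_diff[OF sm sm])
  also have "\<dots> = (\<Sum>k. t n (Suc k) - t (Suc n) (Suc k)) + (t n 0 - t (Suc n) 0)"
    using suminf_split_head[OF summable_diff[OF sm sm, of n "Suc n"]] by simp
  \<comment> \<open>At the node \<open>q^0 = 1\<close> all powers agree, so the shift leaves no
    boundary term.\<close>
  also have "t n 0 - t (Suc n) 0 = 0" by (simp add: t_def)
  also have "(\<lambda>k. t n (Suc k) - t (Suc n) (Suc k)) = (\<lambda>k. q ^ (2 * n + 1) * (t n k - b * t (Suc n) k))"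
  proof
    fix k
    show "t n (Suc k) - t (Suc n) (Suc k) = q ^ (2 * n + 1) * (t n k - b * t (Suc n) k)"
    proof -
    have "t n (Suc k) - t (Suc n) (Suc k)
        = w (Suc k) * (1 - q ^ (2 * Suc k)) * q ^ Suc k * (q ^ (2 * Suc k)) ^ n"
      by (simp add: t_def algebra_simps)
    moreover have shift: "(q ^ (2 * Suc k)) ^ n = (q ^ (2 * k)) ^ n * q ^ (2 * n)"
      by (simp add: power_mult[symmetric] power_add[symmetric] algebra_simps del: power_Suc)
    ultimately show ?thesis
      unfolding w_rec shift t_def by (simp add: algebra_simps)
    qed
  qed
  also have "(\<Sum>k. q ^ (2 * n + 1) * (t n k - b * t (Suc n) k)) + 0
      = q ^ (2 * n + 1) * (moment n - b * moment (Suc n))"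
    unfolding moment_def t_def[symmetric]
    using sm by (simp add: suminf_mult suminf_diff[symmetric] summable_mult summable_diff)
  finally show ?thesis by (simp add: algebra_simps)
qed

text \<open>Iterates \<open>moment_rec\<close>. Writing \<open>q^(2j+1)\<close> as
  \<open>q (q^2)^j\<close> makes both sides partial products of Pochhammer symbols in base
  \<open>q^2\<close>.\<close>

lemma moment_prod:
  "moment n * (\<Prod>j<n. 1 - b * q * (q\<^sup>2) ^ j) = moment 0 * (\<Prod>j<n. 1 - q * (q\<^sup>2) ^ j)"
proof (induction n)
  case (Suc n)
  have e: "q ^ (2 * n + 1) = q * (q\<^sup>2) ^ n" by (simp add: power_mult)
  have "moment (Suc n) * (\<Prod>j<Suc n. 1 - b * q * (q\<^sup>2) ^ j)
      = moment (Suc n) * (1 - b * q ^ (2 * n + 1)) * (\<Prod>j<n. 1 - b * q * (q\<^sup>2) ^ j)"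
    unfolding e by (simp add: mult_ac)
  also have "\<dots> = (1 - q ^ (2 * n + 1)) * (moment n * (\<Prod>j<n. 1 - b * q * (q\<^sup>2) ^ j))"
    unfolding moment_rec[symmetric] by (simp only: mult_ac)
  finally show ?case
    unfolding Suc e by (simp add: mult_ac)
qed simp

text \<open>High powers single out the node \<open>q^0 = 1\<close>. Tannery's theorem applies with
  majorant \<open>w k * q^k\<close>.\<close>

lemma moment_LIMSEQ: "moment \<longlonglongrightarrow> w 0"
proof -
  have "(\<lambda>n. \<Sum>k. w k * q ^ k * (q ^ (2 * k)) ^ n) \<longlonglongrightarrow> (\<Sum>k. if k = 0 then w 0 else 0)"
  proof (rule tannerys_theorem[THEN conjunct2, THEN conjunct2])
    show "(\<lambda>n. w k * q ^ k * (q ^ (2 * k)) ^ n) \<longlonglongrightarrow> (if k = 0 then w 0 else 0)" for k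
    proof (cases "k = 0")
      case False
      have "(\<lambda>n. (q ^ (2 * k)) ^ n) \<longlonglongrightarrow> 0"
        using q_pos q_less_one False by (intro LIMSEQ_realpow_zero) (auto simp: power_less_one_iff)
      then show ?thesis using False by (auto intro: tendsto_mult_right_zero)
    qed simp
    have "norm (w k * q ^ k * (q ^ (2 * k)) ^ n) \<le> w k * q ^ k" for k n
      using w_pos[of k] q_pos q_less_one
      by (simp add: abs_mult mult_left_le power_le_one)
    then show "\<forall>\<^sub>F (k, n) in sequentially \<times>\<^sub>F sequentially.
        norm (w k * q ^ k * (q ^ (2 * k)) ^ n) \<le> w k * q ^ k"
      by (intro always_eventually) auto
  qed (use summable_weight in auto)
  also have "(\<Sum>k. if k = 0 then w 0 else 0) = w 0"
    using suminf_finite[of "{0}" "\<lambda>k. if k = 0 then w 0 else 0"] by simp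
  finally show ?thesis by (simp add: moment_def[abs_def])
qed

lemma bq_less_one: "b * q < 1"
  using b_power_less_one[of 1] by simp

text \<open>This evaluates the \<open>q\<close>-beta integral behind the normalising constant: letting \<open>n \<rightarrow> \<infinity>\<close> in
  \<open>moment_prod\<close> replaces the \<open>q\<close>-binomial theorem.\<close>

lemma moment_0: "moment 0 * qpoch_inf q (q\<^sup>2) = w 0 * qpoch_inf (b * q) (q\<^sup>2)"
proof (rule LIMSEQ_unique)
  show "(\<lambda>n. moment 0 * (\<Prod>j<n. 1 - q * (q\<^sup>2) ^ j)) \<longlonglongrightarrow> moment 0 * qpoch_inf q (q\<^sup>2)"
    using q2_less_one by (intro tendsto_mult_left qpoch_inf_LIMSEQ) auto
  show "(\<lambda>n. moment 0 * (\<Prod>j<n. 1 - q * (q\<^sup>2) ^ j)) \<longlonglongrightarrow> w 0 * qpoch_inf (b * q) (q\<^sup>2)"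
    unfolding moment_prod[symmetric]
    using q2_less_one by (intro tendsto_mult moment_LIMSEQ qpoch_inf_LIMSEQ) auto
qed

text \<open>This says that the operator fixes constants. The Gamma quotient reduces to four
  Pochhammer symbols, which \<open>moment_0\<close> cancels.\<close>

lemma C_const_moment_0: "C_const \<alpha> q * (1 - q) * moment 0 = 1"
proof -
  let ?P = "\<lambda>a. qpoch_inf a (q\<^sup>2)"
  have q2: "q powr 2 = q\<^sup>2" using q_pos by simp
  have pos: "0 < ?P q" "0 < ?P (b * q)" "0 < ?P b" "0 < ?P (q\<^sup>2)"
    using q_pos q_less_one q2_less_one b_less_one bq_less_one by (auto intro!: qpoch_inf_pos)
  have e: "q powr (2 * (\<alpha> + 1)) = b * q" "q powr (2 * (\<alpha> + 1 / 2)) = b" "q powr (2 * (1 / 2)) = q"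
    using q_pos by (auto simp: algebra_simps powr_add q2 power2_eq_square)
  \<comment> \<open>The exponents add up to
    \<open>-\<alpha> - 1/2 - (1/2 - \<alpha>) = -1\<close>.\<close>
  have p: "(1 - q\<^sup>2) powr (1 - (\<alpha> + 1)) / ((1 - q\<^sup>2) powr (1 - 1 / 2) * (1 - q\<^sup>2) powr (1 - (\<alpha> + 1 / 2)))
      = 1 / (1 - q\<^sup>2)"
    using q2_less_one by (simp add: powr_add[symmetric] powr_diff[symmetric] powr_minus_divide)
  have "C_const \<alpha> q = (1 + q) * (?P q * ?P b / (?P (q\<^sup>2) * ?P (b * q)))
      * ((1 - q\<^sup>2) powr (1 - (\<alpha> + 1)) / ((1 - q\<^sup>2) powr (1 - 1 / 2) * (1 - q\<^sup>2) powr (1 - (\<alpha> + 1 / 2))))"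
    unfolding C_const_def qGamma2_def e using pos by (simp add: field_simps)
  also have "\<dots> = (1 + q) * (?P q * ?P b / (?P (q\<^sup>2) * ?P (b * q))) / (1 - q\<^sup>2)"
    unfolding p by simp
  also have "\<dots> = ?P q * ?P b / (?P (q\<^sup>2) * ?P (b * q)) / (1 - q)"
  proof -
    have "1 - q\<^sup>2 = (1 + q) * (1 - q)" by (simp add: power2_eq_square algebra_simps)
    then have "(1 + q) * Z / (1 - q\<^sup>2) = Z / (1 - q)" for Z
      using q_pos by simp
    then show ?thesis .
  qed
  finally have C: "C_const \<alpha> q * (1 - q) = ?P q * ?P b / (?P (q\<^sup>2) * ?P (b * q))"
    using q_less_one by simp
  have M: "moment 0 = ?P (q\<^sup>2) / ?P b * ?P (b * q) / ?P q"
    using moment_0 pos by (simp add: w_eq power2_eq_square field_simps)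
  show ?thesis unfolding C M using pos by (simp add: field_simps)
qed

end

section \<open>The image of the \<open>q\<close>-exponential\<close>

text \<open>Integrates a power series termwise against a discrete measure with masses
  \<open>v k\<close> at points \<open>r k\<close> of [0, 1]. The partial sums in \<open>n\<close>
  are dominated by \<open>\<bar>v k\<bar>\<close> times the sum of \<open>norm (A n)\<close>, so the
  limit may be taken under the sum over \<open>k\<close>.\<close>

lemma sums_swap_powers:
  fixes A :: "nat \<Rightarrow> complex" and v r :: "nat \<Rightarrow> real"
  assumes A: "summable (\<lambda>n. norm (A n))" and v: "summable (\<lambda>k. \<bar>v k\<bar>)"
    and r: "\<And>k. 0 \<le> r k" "\<And>k. r k \<le> 1"
  shows "(\<lambda>n. A n * of_real (\<Sum>k. v k * r k ^ n)) sums
      (\<Sum>k. of_real (v k) * (\<Sum>n. A n * of_real (r k ^ n)))"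
proof -
  have rn: "norm (A n * of_real (r k ^ n)) \<le> norm (A n)" for n k
    using r[of k] by (simp add: norm_mult norm_power mult_left_le power_le_one)
  have sA: "summable (\<lambda>n. A n * of_real (r k ^ n))" for k
    using A rn by (rule summable_comparison_test')
  have sv: "summable (\<lambda>k. v k * r k ^ n)" for n
    using v by (rule summable_comparison_test')
      (use r in \<open>auto simp: abs_mult mult_left_le power_le_one\<close>)
  have "(\<lambda>N. \<Sum>k. of_real (v k) * (\<Sum>n<N. A n * of_real (r k ^ n))) \<longlonglongrightarrow>
      (\<Sum>k. of_real (v k) * (\<Sum>n. A n * of_real (r k ^ n)))"
  proof (rule tannerys_theorem[THEN conjunct2, THEN conjunct2])
    show "(\<lambda>N. of_real (v k) * (\<Sum>n<N. A n * of_real (r k ^ n))) \<longlonglongrightarrow>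
        of_real (v k) * (\<Sum>n. A n * of_real (r k ^ n))" for k
      by (intro tendsto_mult_left summable_LIMSEQ sA)
    have "norm (of_real (v k) * (\<Sum>n<N. A n * of_real (r k ^ n))) \<le> \<bar>v k\<bar> * (\<Sum>n. norm (A n))" for k N
    proof -
      have "norm (\<Sum>n<N. A n * of_real (r k ^ n)) \<le> (\<Sum>n<N. norm (A n))"
        using rn by (intro sum_norm_le) auto
      also have "\<dots> \<le> (\<Sum>n. norm (A n))" using A by (intro sum_le_suminf) auto
      finally show ?thesis by (simp add: norm_mult mult_left_mono)
    qed
    then show "\<forall>\<^sub>F (k, N) in sequentially \<times>\<^sub>F sequentially.
        norm (of_real (v k) * (\<Sum>n<N. A n * of_real (r k ^ n))) \<le> \<bar>v k\<bar> * (\<Sum>n. norm (A n))"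
      by (intro always_eventually) auto
    show "summable (\<lambda>k. \<bar>v k\<bar> * (\<Sum>n. norm (A n)))" using v by (rule summable_mult2)
  qed simp
  moreover have "(\<Sum>k. of_real (v k) * (\<Sum>n<N. A n * of_real (r k ^ n)))
      = (\<Sum>n<N. A n * of_real (\<Sum>k. v k * r k ^ n))" for N
  proof -
    have s: "summable (\<lambda>k. A n * complex_of_real (v k * r k ^ n))" for n
      using sv by (intro summable_mult summable_of_real)
    have "(\<Sum>k. of_real (v k) * (\<Sum>n<N. A n * of_real (r k ^ n)))
        = (\<Sum>k. \<Sum>n<N. A n * of_real (v k * r k ^ n))"
      by (simp add: sum_distrib_left mult_ac)
    also have "\<dots> = (\<Sum>n<N. \<Sum>k. A n * of_real (v k * r k ^ n))"
      using s by (intro suminf_sum) auto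
    also have "\<dots> = (\<Sum>n<N. A n * of_real (\<Sum>k. v k * r k ^ n))"
      by (simp only: suminf_mult[OF summable_of_real[OF sv]] suminf_of_real[OF sv])
    finally show ?thesis .
  qed
  ultimately show ?thesis by (simp add: sums_def)
qed

section \<open>Power series of the q-cosine and q-sine\<close>

definition cos_term :: "real \<Rightarrow> complex \<Rightarrow> nat \<Rightarrow> complex" where
  "cos_term q z n = (-1) ^ n * of_real (q ^ (n * (n + 1))) * z ^ (2 * n) / of_real (qfact q (2 * n))"

definition sin_term :: "real \<Rightarrow> complex \<Rightarrow> nat \<Rightarrow> complex" where
  "sin_term q z n =
     (-1) ^ n * of_real (q ^ (n * (n + 1))) * z ^ (2 * n + 1) / of_real (qfact q (2 * n + 1))"

text \<open>The term is the \<open>n\<close>-th power of \<open>q^(n+1) y\<close>, whose modulus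
  eventually stays below 1/2.\<close>

lemma summable_gaussian:
  fixes q y :: real
  assumes "0 < q" "q < 1"
  shows "summable (\<lambda>n. q ^ (n * (n + 1)) * y ^ n)"
proof -
  have "(\<lambda>n. q ^ Suc n * \<bar>y\<bar>) \<longlonglongrightarrow> 0 * \<bar>y\<bar>"
    using assms by (intro tendsto_mult_right LIMSEQ_Suc[OF LIMSEQ_realpow_zero]) auto
  then have "\<forall>\<^sub>F n in sequentially. q ^ Suc n * \<bar>y\<bar> < 1 / 2"
    by (rule order_tendstoD) simp
  then have "\<forall>\<^sub>F n in sequentially. norm (q ^ (n * (n + 1)) * y ^ n) \<le> (1 / 2) ^ n"
  proof eventually_elim
    case (elim n)
    have "norm (q ^ (n * (n + 1)) * y ^ n) = (q ^ Suc n * \<bar>y\<bar>) ^ n"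
      using assms by (simp only: real_norm_def abs_mult power_abs power_mult_distrib power_mult[symmetric]
        abs_of_pos zero_less_power) (simp add: mult.commute)
    also have "\<dots> \<le> (1 / 2) ^ n" using elim assms by (intro power_mono) auto
    finally show ?case .
  qed
  then show ?thesis
    by (rule summable_comparison_test_ev) (simp add: summable_geometric)
qed

lemma summable_cos_term:
  assumes "0 < q" "q < 1"
  shows "summable (\<lambda>n. norm (cos_term q z n))"
proof (rule summable_comparison_test')
  show "summable (\<lambda>n. q ^ (n * (n + 1)) * ((norm z)\<^sup>2) ^ n)" by (rule summable_gaussian[OF assms])
  fix n
  have "norm (cos_term q z n) = q ^ (n * (n + 1)) * ((norm z)\<^sup>2) ^ n / qfact q (2 * n)"
    using assms qfact_ge_one[OF assms, of "2 * n"]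
    by (simp add: cos_term_def norm_mult norm_divide norm_power power_mult)
  also have "\<dots> \<le> q ^ (n * (n + 1)) * ((norm z)\<^sup>2) ^ n / 1"
    using assms qfact_ge_one[OF assms, of "2 * n"] by (intro divide_left_mono) auto
  finally show "norm (norm (cos_term q z n)) \<le> q ^ (n * (n + 1)) * ((norm z)\<^sup>2) ^ n" by simp
qed

lemma summable_sin_term:
  assumes "0 < q" "q < 1"
  shows "summable (\<lambda>n. norm (sin_term q z n))"
proof (rule summable_comparison_test')
  show "summable (\<lambda>n. norm z * (q ^ (n * (n + 1)) * ((norm z)\<^sup>2) ^ n))"
    by (intro summable_mult summable_gaussian[OF assms])
  fix n
  have "norm (sin_term q z n) = norm z * (q ^ (n * (n + 1)) * ((norm z)\<^sup>2) ^ n) / qfact q (2 * n + 1)"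
    using assms qfact_ge_one[OF assms, of "2 * n + 1"]
    by (simp add: sin_term_def norm_mult norm_divide norm_power power_mult)
  also have "\<dots> \<le> norm z * (q ^ (n * (n + 1)) * ((norm z)\<^sup>2) ^ n) / 1"
    using assms qfact_ge_one[OF assms, of "2 * n + 1"] by (intro divide_left_mono) auto
  finally show "norm (norm (sin_term q z n)) \<le> norm z * (q ^ (n * (n + 1)) * ((norm z)\<^sup>2) ^ n)" by simp
qed

lemma qcos_scale: "qcos q (z * of_real s) = (\<Sum>n. cos_term q z n * of_real ((s\<^sup>2) ^ n))"
  unfolding qcos_def cos_term_def by (intro suminf_cong) (simp add: power_mult_distrib power_mult)

text \<open>With one factor \<open>s\<close> taken out, only powers of \<open>s^2\<close> remain,
  the shape that \<open>sums_swap_powers\<close> handles. Convergence of the remaining series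
  follows from \<open>\<bar>s\<bar> \<le> 1\<close> by comparison.\<close>

lemma qsin_scale:
  assumes "0 < q" "q < 1" "\<bar>s\<bar> \<le> 1"
  shows "qsin q (z * of_real s) = of_real s * (\<Sum>n. sin_term q z n * of_real ((s\<^sup>2) ^ n))"
proof -
  have "s\<^sup>2 \<le> 1" using assms(3) by (simp add: abs_square_le_1)
  then have "norm (sin_term q z n * of_real ((s\<^sup>2) ^ n)) \<le> norm (sin_term q z n)" for n
    by (simp add: norm_mult norm_power mult_left_le power_le_one)
  then have "summable (\<lambda>n. sin_term q z n * of_real ((s\<^sup>2) ^ n))"
    by (intro summable_comparison_test'[OF summable_sin_term[OF assms(1,2)]])
  then have "of_real s * (\<Sum>n. sin_term q z n * of_real ((s\<^sup>2) ^ n))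
      = (\<Sum>n. of_real s * (sin_term q z n * of_real ((s\<^sup>2) ^ n)))"
    by (rule suminf_mult[symmetric])
  moreover have "(z * of_real s) ^ (2 * n + 1) = of_real s * z ^ (2 * n + 1) * of_real ((s\<^sup>2) ^ n)" for n
    by (simp add: power_mult_distrib power_mult[symmetric])
  ultimately show ?thesis
    unfolding qsin_def sin_term_def by (simp add: mult_ac del: power_Suc of_real_power)
qed

section \<open>Coefficients of the normalised Bessel functions\<close>

definition j_coeff :: "real \<Rightarrow> real \<Rightarrow> nat \<Rightarrow> real" where
  "j_coeff q \<beta> n = qGamma2 q (\<beta> + 1) / (qGamma2 q (\<beta> + real n + 1) * qGamma2 q (real n + 1)) / (1 + q) ^ (2 * n)"

text \<open>The factor \<open>q^(n(n+1))\<close> and the sign stay outside \<open>j_coeff\<close>,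
  since cosine and sine carry the same ones.\<close>

lemma j_fun_eq:
  "j_fun \<beta> q z = (\<Sum>n. (-1) ^ n * of_real (q ^ (n * (n + 1)) * j_coeff q \<beta> n) * z ^ (2 * n))"
  unfolding j_fun_def j_coeff_def by (intro suminf_cong) (simp add: power_divide)

lemma j_coeff_0:
  assumes "0 < q" "q < 1" "\<beta> > - 1"
  shows "j_coeff q \<beta> 0 = 1"
  using assms qGamma2_pos[of q "\<beta> + 1"] by (simp add: j_coeff_def qGamma2_one)

text \<open>The functional equation is applied to both Gamma factors. Of the resulting
  \<open>(1 - q^2)^2\<close>, the part \<open>(1 + q)^2\<close> cancels against the power of
  \<open>1 + q\<close>.\<close>

lemma j_coeff_Suc:
  assumes "0 < q" "q < 1" "\<beta> > - 1"
  shows "j_coeff q \<beta> (Suc n)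
    = j_coeff q \<beta> n * ((1 - q)\<^sup>2 / ((1 - q powr (2 * \<beta> + 2) * q ^ (2 * n)) * (1 - q ^ (2 * n + 2))))"
proof -
  let ?G = "qGamma2 q"
  have pw: "q powr (2 * (\<beta> + real n + 1)) = q powr (2 * \<beta> + 2) * q ^ (2 * n)"
    using assms powr_add[of q "2 * \<beta> + 2" "real (2 * n)"] powr_realpow[of q "2 * n"]
    by (simp add: algebra_simps)
  have pw': "q powr (2 * (real n + 1)) = q ^ (2 * n + 2)"
    using assms powr_realpow[of q "2 * n + 2"] by (simp add: algebra_simps)
  have G1: "?G (\<beta> + real (Suc n) + 1)
      = (1 - q powr (2 * \<beta> + 2) * q ^ (2 * n)) / (1 - q\<^sup>2) * ?G (\<beta> + real n + 1)"
    using qGamma2_add_one[of q "\<beta> + real n + 1"] assms unfolding pw by (simp add: add_ac)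
  have G2: "?G (real (Suc n) + 1) = (1 - q ^ (2 * n + 2)) / (1 - q\<^sup>2) * ?G (real n + 1)"
    using qGamma2_add_one[of q "real n + 1"] assms unfolding pw' by (simp add: add_ac)
  have fact: "1 - q\<^sup>2 = (1 - q) * (1 + q)" by (simp add: power2_eq_square algebra_simps)
  have alg: "g / (u / (s * t) * g1 * (v / (s * t) * g2)) / (t\<^sup>2 * T) = g / (g1 * g2) / T * (s\<^sup>2 / (u * v))"
    if "t \<noteq> 0" for g u v s t g1 g2 T :: real
    using that by (simp add: power2_eq_square mult_ac)
  have pow: "(1 + q) ^ (2 * Suc n) = (1 + q)\<^sup>2 * (1 + q) ^ (2 * n)"
    by (simp add: power2_eq_square)
  show ?thesis
    unfolding j_coeff_def G1 G2 fact pow by (rule alg) (use assms in simp)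
qed

section \<open>Moments matched with Bessel coefficients\<close>

context q_dunkl
begin

abbreviation K :: real where "K \<equiv> C_const \<alpha> q * (1 - q)"

lemma b_q_power: "q powr (2 * \<alpha> + 2) = b * q"
  using q_pos powr_add[of q "2 * \<alpha> + 1" 1] by (simp add: add_ac)

lemma moment_Suc: "moment (Suc n) = moment n * ((1 - q ^ (2 * n + 1)) / (1 - b * q ^ (2 * n + 1)))"
  using moment_rec[of n] b_power_less_one[of "2 * n + 1"] by (simp add: field_simps)

text \<open>Both sides equal 1 at \<open>n = 0\<close> and obey the same first-order recurrence: the
  numerator of the moment ratio cancels the odd bracket gained by the factorial.\<close>

lemma cos_coeff: "K * moment n / qfact q (2 * n) = j_coeff q \<alpha> n"
proof (induction n)
  case 0
  show ?case using C_const_moment_0 j_coeff_0[of q \<alpha>] q_pos q_less_one alpha by (simp add: qfact_def)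
next
  case (Suc n)
  let ?u = "1 - q ^ (2 * n + 1)" and ?v = "1 - q ^ (2 * n + 2)" and ?d = "1 - b * q ^ (2 * n + 1)"
  have u: "?u \<noteq> 0" using q_power_less_one[of "2 * n + 1"] by simp
  have F: "qfact q (2 * Suc n) = qfact q (2 * n) * (?u / (1 - q)) * (?v / (1 - q))"
    using q_pos qbracket_nat[of q "2 * n + 1"] qbracket_nat[of q "2 * n + 2"]
    by (simp add: qfact_Suc)
  have alg: "k * (m * (u / d)) / (f * (u / s) * (v / s)) = k * m / f * (s\<^sup>2 / (d * v))"
    if "u \<noteq> 0" for k m u d f s v :: real
    using that by (simp add: power2_eq_square mult_ac)
  have "K * moment (Suc n) / qfact q (2 * Suc n) = K * moment n / qfact q (2 * n) * ((1 - q)\<^sup>2 / (?d * ?v))"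
    unfolding F moment_Suc by (rule alg) (rule u)
  also have "\<dots> = j_coeff q \<alpha> (Suc n)"
    using Suc j_coeff_Suc[of q \<alpha> n] q_pos q_less_one alpha by (simp add: b_q_power mult.assoc)
  finally show ?case .
qed

text \<open>The moment has index \<open>Suc n\<close> because the factor \<open>t\<close> in
  \<open>1 + t\<close> lifts \<open>t^(2n+1)\<close> to \<open>t^(2n+2)\<close>. The first term is
  \<open>(1 - q) / (1 - b q)\<close>, the reciprocal of the bracket; from there the recurrences
  agree as for the cosine.\<close>

lemma sin_coeff:
  "K * moment (Suc n) / qfact q (2 * n + 1) = j_coeff q (\<alpha> + 1) n / qbracket q (2 * \<alpha> + 2)"
proof (induction n)
  case 0
  show ?case
  proof -
    have "K * moment (Suc 0) = K * moment 0 * ((1 - q) / (1 - b * q))"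
      unfolding moment_Suc by simp
    also have "\<dots> = (1 - q) / (1 - b * q)"
      unfolding C_const_moment_0 by simp
    finally have M: "K * moment (Suc 0) = (1 - q) / (1 - b * q)" .
    have "qfact q (2 * 0 + 1) = 1"
      using q_pos q_less_one by (simp add: qfact_def qbracket_def)
    then show ?thesis
      unfolding M using j_coeff_0[of q "\<alpha> + 1"] q_pos q_less_one alpha
      by (simp add: b_q_power qbracket_def)
  qed
next
  case (Suc n)
  let ?u = "1 - q ^ (2 * n + 3)" and ?v = "1 - q ^ (2 * n + 2)" and ?d = "1 - b * q ^ (2 * n + 3)"
  have u: "?u \<noteq> 0" using q_power_less_one[of "2 * n + 3"] by simp
  have F: "qfact q (2 * Suc n + 1) = qfact q (2 * n + 1) * (?v / (1 - q)) * (?u / (1 - q))"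
    using q_pos qbracket_nat[of q "2 * n + 3"] qbracket_nat[of q "2 * n + 2"]
    by (simp add: qfact_Suc numeral_3_eq_3)
  have M: "moment (Suc (Suc n)) = moment (Suc n) * (?u / ?d)"
    using moment_Suc[of "Suc n"] by (simp add: numeral_3_eq_3)
  have B: "q powr (2 * (\<alpha> + 1) + 2) * q ^ (2 * n) = b * q ^ (2 * n + 3)"
    using q_pos powr_add[of q "2 * \<alpha> + 1" 3] by (simp add: add_ac power_add algebra_simps)
  have alg: "k * (m * (u / d)) / (f * (v / s) * (u / s)) = k * m / f * (s\<^sup>2 / (d * v))"
    if "u \<noteq> 0" for k m u d f s v :: real
    using that by (simp add: power2_eq_square mult_ac)
  have "K * moment (Suc (Suc n)) / qfact q (2 * Suc n + 1)
      = K * moment (Suc n) / qfact q (2 * n + 1) * ((1 - q)\<^sup>2 / (?d * ?v))"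
    unfolding F M by (rule alg) (rule u)
  also have "\<dots> = j_coeff q (\<alpha> + 1) (Suc n) / qbracket q (2 * \<alpha> + 2)"
    unfolding Suc using j_coeff_Suc[of q "\<alpha> + 1" n, unfolded B] q_pos q_less_one alpha by simp
  finally show ?case .
qed

section \<open>The intertwining operator as a series over the nodes\<close>

lemma W_weight_even: "W_weight \<alpha> q (- t) = W_weight \<alpha> q t"
  by (simp add: W_weight_def)

lemma V_op_eq:
  "V_op \<alpha> q f x = of_real (K / 2) * (\<Sum>k. of_real (w k * q ^ k) *
      (of_real (1 + q ^ k) * f (x * q ^ k) + of_real (1 - q ^ k) * f (- (x * q ^ k))))"
  unfolding V_op_def qintegral_def W_weight_even w_def by (simp add: algebra_simps)

text \<open>Pairing the nodes \<open>q^k\<close> and \<open>- q^k\<close>, the even part of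
  \<open>1 + t\<close> meets the even part of \<open>f\<close> and the odd part meets the odd part.
  Boundedness makes the two series converge separately.\<close>

lemma V_op_even_odd:
  assumes "\<And>k. cmod (f (x * q ^ k)) \<le> B" "\<And>k. cmod (f (- (x * q ^ k))) \<le> B"
  shows "summable (\<lambda>k. of_real (w k * q ^ k) * even_part f (x * q ^ k))"
    and "summable (\<lambda>k. of_real (w k * q ^ k) * (of_real (q ^ k) * odd_part f (x * q ^ k)))"
    and "V_op \<alpha> q f x = of_real K *
      ((\<Sum>k. of_real (w k * q ^ k) * even_part f (x * q ^ k)) +
       (\<Sum>k. of_real (w k * q ^ k) * (of_real (q ^ k) * odd_part f (x * q ^ k))))"
proof -
  have E: "cmod (even_part f (x * q ^ k)) \<le> B" for k
    using norm_triangle_ineq[of "f (x * q ^ k)" "f (- (x * q ^ k))"] assms[of k]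
    by (simp add: even_part_def norm_divide)
  have O': "cmod (odd_part f (x * q ^ k)) \<le> B" for k
    using norm_triangle_ineq4[of "f (x * q ^ k)" "f (- (x * q ^ k))"] assms[of k]
    by (simp add: odd_part_def norm_divide)
  have O: "cmod (of_real (q ^ k) * odd_part f (x * q ^ k)) \<le> B" for k
  proof -
    have "cmod (of_real (q ^ k) * odd_part f (x * q ^ k)) \<le> cmod (odd_part f (x * q ^ k))"
      using q_pos q_less_one by (simp add: norm_mult norm_power mult_left_le_one_le power_le_one)
    then show ?thesis using O'[of k] by linarith
  qed
  show sE: "summable (\<lambda>k. of_real (w k * q ^ k) * even_part f (x * q ^ k))"
    by (rule summable_weight_bounded[OF E])
  show sO: "summable (\<lambda>k. of_real (w k * q ^ k) * (of_real (q ^ k) * odd_part f (x * q ^ k)))"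
    by (rule summable_weight_bounded[OF O])
  have split: "of_real (1 + q ^ k) * f (x * q ^ k) + of_real (1 - q ^ k) * f (- (x * q ^ k))
      = 2 * (even_part f (x * q ^ k) + of_real (q ^ k) * odd_part f (x * q ^ k))" for k
    by (simp add: even_part_def odd_part_def field_simps)
  have "V_op \<alpha> q f x = of_real (K / 2) * (\<Sum>k. 2 *
      (of_real (w k * q ^ k) * even_part f (x * q ^ k) +
       of_real (w k * q ^ k) * (of_real (q ^ k) * odd_part f (x * q ^ k))))"
    unfolding V_op_eq split by (simp add: algebra_simps)
  also have "\<dots> = of_real K * (\<Sum>k.
      of_real (w k * q ^ k) * even_part f (x * q ^ k) +
       of_real (w k * q ^ k) * (of_real (q ^ k) * odd_part f (x * q ^ k)))"
    by (subst suminf_mult[OF summable_add[OF sE sO]]) simp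
  finally show "V_op \<alpha> q f x = of_real K *
      ((\<Sum>k. of_real (w k * q ^ k) * even_part f (x * q ^ k)) +
       (\<Sum>k. of_real (w k * q ^ k) * (of_real (q ^ k) * odd_part f (x * q ^ k))))"
    by (simp only: suminf_add[OF sE sO])
qed

text \<open>Along the nodes the even part of the exponential is the cosine series and the odd part
  the sine series. Each is integrated termwise and compared coefficient by coefficient through
  \<open>cos_coeff\<close> and \<open>sin_coeff\<close>.\<close>

lemma V_op_qexp:
  assumes "\<mu> * x \<noteq> 0"
  shows "V_op \<alpha> q (\<lambda>y. qexp q (- \<i> * of_real \<mu> * of_real y)) x = psi \<alpha> q (- \<mu>) x"
proof -
  define z where "z = complex_of_real (\<mu> * x)"
  define f where "f = (\<lambda>y::real. qexp q (- \<i> * of_real \<mu> * of_real y))"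
  define c where "c k = (\<Sum>n. cos_term q z n * of_real ((q ^ (2 * k)) ^ n))" for k
  define s where "s k = (\<Sum>n. sin_term q z n * of_real ((q ^ (2 * k)) ^ n))" for k
  define B where "B = (\<Sum>n. norm (cos_term q z n)) + (\<Sum>n. norm (sin_term q z n))"
  have sc: "summable (\<lambda>n. norm (cos_term q z n))" and ss: "summable (\<lambda>n. norm (sin_term q z n))"
    using q_pos q_less_one by (auto intro: summable_cos_term summable_sin_term)
  have qk: "0 \<le> q ^ k" "q ^ k \<le> 1" for k using q_pos q_less_one by (auto intro: power_le_one)
  \<comment> \<open>The sign \<open>\<sigma>\<close> treats both nodes at once. The minus sign
    before \<open>\<sigma>\<close> on the right comes from
    \<open>(- \<i>) * (- \<i>) = -1\<close>.\<close>
  have fk: "f (x * \<sigma> * q ^ k) = c k - \<i> * of_real (\<sigma> * q ^ k) * s k" if "\<bar>\<sigma>\<bar> = 1" for \<sigma> k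
  proof -
    have sq: "(- (\<sigma> * q ^ k))\<^sup>2 = q ^ (2 * k)"
      using that power2_abs[of \<sigma>] by (simp add: power_mult_distrib power_mult[symmetric] mult.commute)
    have "- \<i> * (- \<i> * of_real \<mu> * of_real (x * \<sigma> * q ^ k)) = z * of_real (- (\<sigma> * q ^ k))"
      by (simp add: z_def algebra_simps)
    then have "f (x * \<sigma> * q ^ k) = qcos q (z * of_real (- (\<sigma> * q ^ k))) + \<i> * qsin q (z * of_real (- (\<sigma> * q ^ k)))"
      by (simp only: f_def qexp_def)
    moreover have "\<bar>- (\<sigma> * q ^ k)\<bar> \<le> 1" using that qk[of k] by (simp add: abs_mult)
    ultimately show ?thesis
      by (simp only: qcos_scale qsin_scale[OF q_pos q_less_one] sq c_def s_def) simp
  qed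
  have bound: "cmod (\<Sum>n. a n * of_real ((q ^ (2 * k)) ^ n)) \<le> (\<Sum>n. norm (a n))"
    if "summable (\<lambda>n. norm (a n))" for a :: "nat \<Rightarrow> complex" and k
    using that qk[of "2 * k"] q_pos
    by (intro norm_suminf_le) (auto simp: norm_mult norm_power mult_left_le power_le_one)
  have B: "cmod (f (x * \<sigma> * q ^ k)) \<le> B" if "\<bar>\<sigma>\<bar> = 1" for \<sigma> k
  proof -
    have "cmod (\<i> * of_real (\<sigma> * q ^ k) * s k) \<le> cmod (s k)"
      using that qk[of k] q_pos by (simp add: norm_mult norm_power mult_left_le_one_le)
    moreover have "cmod (f (x * \<sigma> * q ^ k)) = cmod (c k - \<i> * of_real (\<sigma> * q ^ k) * s k)"
      by (simp only: fk[OF that])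
    ultimately show ?thesis
      using bound[OF sc, of k] bound[OF ss, of k]
        norm_triangle_ineq4[of "c k" "\<i> * of_real (\<sigma> * q ^ k) * s k"]
      unfolding B_def c_def s_def by linarith
  qed
  have e: "even_part f (x * q ^ k) = c k" and o: "odd_part f (x * q ^ k) = - \<i> * of_real (q ^ k) * s k" for k
    using fk[of 1 k] fk[of "-1" k] by (auto simp: even_part_def odd_part_def)
  have V: "V_op \<alpha> q f x = of_real K * ((\<Sum>k. of_real (w k * q ^ k) * c k) +
      (\<Sum>k. of_real (w k * q ^ k) * (of_real (q ^ k) * (- \<i> * of_real (q ^ k) * s k))))"
    and sO: "summable (\<lambda>k. of_real (w k * q ^ k) * (of_real (q ^ k) * (- \<i> * of_real (q ^ k) * s k)))"
    using V_op_even_odd[of f x B] B[of 1] B[of "-1"] unfolding e o by auto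
  \<comment> \<open>One \<open>q^k\<close> from \<open>1 + t\<close> and one from the sine combine
    to \<open>q^(2k)\<close>, which raises the moment index by one.\<close>
  have "(\<Sum>k. of_real (w k * q ^ k) * (of_real (q ^ k) * (- \<i> * of_real (q ^ k) * s k)))
      = (\<Sum>k. - \<i> * (of_real (w k * q ^ k * q ^ (2 * k)) * s k))"
    by (intro suminf_cong) (simp add: power_mult power2_eq_square power_mult_distrib mult_2 power_add mult_ac)
  also have "\<dots> = - \<i> * (\<Sum>k. of_real (w k * q ^ k * q ^ (2 * k)) * s k)"
  proof (rule suminf_mult)
    \<comment> \<open>Multiplication by \<open>\<i>\<close> undoes the factor \<open>- \<i>\<close>
      in \<open>sO\<close>.\<close>
    have "summable (\<lambda>k. \<i> * (of_real (w k * q ^ k) * (of_real (q ^ k) * (- \<i> * of_real (q ^ k) * s k))))"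
      using sO by (rule summable_mult)
    then show "summable (\<lambda>k. of_real (w k * q ^ k * q ^ (2 * k)) * s k)"
      by (simp add: power_add mult_2 power2_eq_square mult_2_right mult_ac)
  qed
  finally have Vs: "V_op \<alpha> q f x = of_real K * (\<Sum>k. of_real (w k * q ^ k) * c k)
      - \<i> * (of_real K * (\<Sum>k. of_real (w k * q ^ k * q ^ (2 * k)) * s k))"
    using V by (simp add: algebra_simps)

  have "(\<lambda>n. cos_term q z n * of_real (moment n)) sums (\<Sum>k. of_real (w k * q ^ k) * c k)"
    unfolding moment_def c_def
    by (rule sums_swap_powers[OF sc]) (use summable_weight w_pos q_pos qk in \<open>auto simp: abs_mult less_imp_le\<close>)
  then have "(\<lambda>n. of_real K * (cos_term q z n * of_real (moment n))) sums
      (of_real K * (\<Sum>k. of_real (w k * q ^ k) * c k))"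
    by (rule sums_mult)
  moreover have "of_real K * (cos_term q z n * of_real (moment n))
      = (-1) ^ n * of_real (q ^ (n * (n + 1)) * j_coeff q \<alpha> n) * z ^ (2 * n)" for n
    unfolding cos_coeff[symmetric] by (simp add: cos_term_def)
  ultimately have C: "of_real K * (\<Sum>k. of_real (w k * q ^ k) * c k) = j_fun \<alpha> q z"
    by (simp add: j_fun_eq sums_iff)

  have mom: "(\<Sum>k. w k * q ^ k * q ^ (2 * k) * (q ^ (2 * k)) ^ n) = moment (Suc n)" for n
    by (simp add: moment_def mult_ac)
  have "(\<lambda>n. sin_term q z n * of_real (\<Sum>k. w k * q ^ k * q ^ (2 * k) * (q ^ (2 * k)) ^ n)) sums
      (\<Sum>k. of_real (w k * q ^ k * q ^ (2 * k)) * s k)"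
    unfolding s_def
    by (rule sums_swap_powers[OF ss])
      (use summable_moment[of 1] w_pos q_pos qk in \<open>auto simp: abs_mult less_imp_le\<close>)
  then have S: "(\<lambda>n. of_real K * (sin_term q z n * of_real (moment (Suc n)))) sums
      (of_real K * (\<Sum>k. of_real (w k * q ^ k * q ^ (2 * k)) * s k))"
    unfolding mom by (rule sums_mult)
  \<comment> \<open>The prefactor of the second Bessel function; it is non-zero because
    \<open>\<mu> * x\<close> is, so the series may be divided by it.\<close>
  define d where "d = z / of_real (qbracket q (2 * \<alpha> + 2))"
  have "qbracket q (2 * \<alpha> + 2) \<noteq> 0"
    using bq_less_one q_less_one by (simp add: qbracket_def b_q_power)
  then have d: "d \<noteq> 0" using assms by (simp add: d_def z_def)
  have "of_real K * (sin_term q z n * of_real (moment (Suc n)))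
      = d * ((-1) ^ n * of_real (q ^ (n * (n + 1)) * j_coeff q (\<alpha> + 1) n) * z ^ (2 * n))" for n
  proof -
    have "of_real K * (sin_term q z n * of_real (moment (Suc n)))
      = z * ((-1) ^ n * of_real (q ^ (n * (n + 1)) * (K * moment (Suc n) / qfact q (2 * n + 1))) * z ^ (2 * n))"
      by (simp add: sin_term_def)
    then show ?thesis unfolding sin_coeff by (simp add: d_def)
  qed
  then have "(\<lambda>n. (-1) ^ n * of_real (q ^ (n * (n + 1)) * j_coeff q (\<alpha> + 1) n) * z ^ (2 * n)) sums
      (of_real K * (\<Sum>k. of_real (w k * q ^ k * q ^ (2 * k)) * s k) / d)"
    using sums_divide[OF S, of d] d by simp
  then have D: "of_real K * (\<Sum>k. of_real (w k * q ^ k * q ^ (2 * k)) * s k) = d * j_fun (\<alpha> + 1) q z"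
    using d by (simp add: j_fun_eq sums_iff field_simps)
  \<comment> \<open>By evenness, replacing \<open>\<mu>\<close> by \<open>- \<mu>\<close> in
    \<open>psi\<close> changes only the sign of the second term.\<close>
  have "j_fun \<beta> q (- z) = j_fun \<beta> q z" for \<beta> by (simp add: j_fun_def)
  then have "psi \<alpha> q (- \<mu>) x = j_fun \<alpha> q z - \<i> * (d * j_fun (\<alpha> + 1) q z)"
    by (simp add: psi_def z_def d_def)
  then show ?thesis
    using Vs unfolding C D f_def by simp
qed

end

section \<open>Transmutation\<close>

lemma tendsto_compose_within:
  assumes "(f \<longlongrightarrow> L) (at a within S)" "X \<longlonglongrightarrow> a" "\<And>k. X k \<in> S" "a \<notin> S"
  shows "(\<lambda>k. f (X k)) \<longlonglongrightarrow> L"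
proof (rule filterlim_compose[OF assms(1)])
  show "filterlim X (at a within S) sequentially"
    unfolding filterlim_at using assms(2-4) by (auto intro!: always_eventually)
qed

text \<open>The two values at \<open>z/q\<close> combine to an even part, those at \<open>qz\<close>
  to an odd part, and \<open>- 2 f(-z)\<close> supplies one of each at \<open>z\<close>.\<close>

lemma dq_eq:
  "dq q f z = (even_part f (inverse q * z) - even_part f z + (odd_part f z - odd_part f (q * z)))
    / of_real ((1 - q) * z)"
proof -
  have "f (inverse q * z) + f (- (inverse q * z)) - f (q * z) + f (- (q * z)) - 2 * f (- z)
      = 2 * (even_part f (inverse q * z) - even_part f z + (odd_part f z - odd_part f (q * z)))"
    by (simp add: even_part_def odd_part_def field_simps)
  moreover have "complex_of_real (2 * (1 - q) * z) = 2 * of_real ((1 - q) * z)"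
    by (simp only: of_real_mult of_real_numeral mult.assoc)
  ultimately show ?thesis
    unfolding dq_def by (simp only: mult_divide_mult_cancel_left zero_neq_numeral[symmetric] not_False_eq_True)
qed

text \<open>Division by the odd function \<open>z\<close> swaps parities, so the odd part of
  \<open>f\<close> produces the even part of its derivative.\<close>

lemma even_part_dq:
  "even_part (dq q f) z = (odd_part f z - odd_part f (q * z)) / of_real ((1 - q) * z)"
  unfolding even_part_def[of "dq q f"] dq_eq
  by (simp add: even_part_def odd_part_def divide_simps)

lemma odd_part_dq:
  "odd_part (dq q f) z = (even_part f (inverse q * z) - even_part f z) / of_real ((1 - q) * z)"
  unfolding odd_part_def[of "dq q f"] dq_eq
  by (simp add: even_part_def odd_part_def divide_simps)

context q_dunkl
begin

section \<open>The lattice, its accumulation at 0, and bounds on it\<close>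

lemma zero_notin_Rq: "0 \<notin> Rq q"
  using q_pos by (auto simp: Rq_def)

lemma Rq_minus: "x \<in> Rq q \<Longrightarrow> - x \<in> Rq q"
  unfolding Rq_def by auto

lemma Rq_mult_powi: "x \<in> Rq q \<Longrightarrow> q powi m * x \<in> Rq q"
  using q_pos unfolding Rq_def by (auto simp: power_int_add[symmetric])

lemma Rq_q: "x \<in> Rq q \<Longrightarrow> q * x \<in> Rq q" "x \<in> Rq q \<Longrightarrow> inverse q * x \<in> Rq q"
  "x \<in> Rq q \<Longrightarrow> x * q ^ k \<in> Rq q"
  using Rq_mult_powi[of x 1] Rq_mult_powi[of x "-1"] Rq_mult_powi[of x "int k"]
  by (simp_all add: power_int_minus mult.commute)

lemma LIMSEQ_mult_q_power: "(\<lambda>k. x * q ^ k) \<longlonglongrightarrow> 0"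
  using q_pos q_less_one by (auto intro!: tendsto_mult_right_zero LIMSEQ_realpow_zero)

text \<open>The powers of \<open>q\<close> accumulate at 0. Hence limits along the lattice are
  unique and \<open>value0\<close> is the limit whenever one exists.\<close>

lemma at_zero_Rq_nontrivial: "at 0 within Rq q \<noteq> bot"
proof -
  have "(1::real) \<in> Rq q" by (auto simp: Rq_def intro: exI[of _ 0])
  then have "q ^ k \<in> Rq q - {0}" for k
    using Rq_q(3)[of 1 k] q_pos by simp
  then have "0 islimpt Rq q"
    unfolding islimpt_sequential using LIMSEQ_mult_q_power[of 1]
    by (intro exI[of _ "\<lambda>k. q ^ k"]) simp
  then show ?thesis by (simp add: trivial_limit_within)
qed

text \<open>The instance \<open>n = 1\<close> of the boundedness clause covers \<open>f\<close> and
  its first derivative with a single constant.\<close>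

lemma Eq_space_bounded:
  assumes "f \<in> Eq_space q" "0 \<le> a"
  obtains B where "\<And>y. y \<in> Rq q \<Longrightarrow> \<bar>y\<bar> \<le> a \<Longrightarrow> cmod (f y) \<le> B"
    and "\<And>y. y \<in> Rq q \<Longrightarrow> \<bar>y\<bar> \<le> a \<Longrightarrow> cmod (dq q f y) \<le> B"
proof -
  let ?S = "{cmod ((dq q ^^ k) f x) | k x. k \<le> 1 \<and> x \<in> {-a..a} \<inter> Rq q}"
  have "\<forall>n. \<forall>a\<ge>0. bdd_above {cmod ((dq q ^^ k) f x) | k x. k \<le> n \<and> x \<in> {-a..a} \<inter> Rq q}"
    using assms(1) unfolding Eq_space_def by simp
  from spec[OF this, of 1] have "bdd_above ?S" using assms(2) by simp
  then obtain B where B: "\<And>s. s \<in> ?S \<Longrightarrow> s \<le> B" by (auto simp: bdd_above_def)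
  show ?thesis
  proof (rule that[of B])
    fix y assume y: "y \<in> Rq q" "\<bar>y\<bar> \<le> a"
    have "cmod ((dq q ^^ k) f y) \<in> ?S" if "k \<le> 1" for k
      using y that by (intro CollectI exI[of _ k] exI[of _ y]) (auto simp: abs_le_iff)
    from B[OF this[of 0]] B[OF this[of 1]] show "cmod (f y) \<le> B" "cmod (dq q f y) \<le> B"
      by simp_all
  qed
qed

text \<open>Up to the factor \<open>K\<close>, this and \<open>odd_sum\<close> are the even and odd
  parts of the image of \<open>f\<close>, when the series converge.\<close>

definition even_sum :: "(real \<Rightarrow> complex) \<Rightarrow> real \<Rightarrow> complex" where
  "even_sum f x = (\<Sum>k. of_real (w k * q ^ k) * even_part f (x * q ^ k))"

definition odd_sum :: "(real \<Rightarrow> complex) \<Rightarrow> real \<Rightarrow> complex" where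
  "odd_sum f x = (\<Sum>k. of_real (w k * q ^ k) * (of_real (q ^ k) * odd_part f (x * q ^ k)))"

lemma even_sum_minus: "even_sum f (- x) = even_sum f x"
  by (simp add: even_sum_def even_part_def add.commute)

lemma odd_sum_minus:
  assumes "summable (\<lambda>k. of_real (w k * q ^ k) * (of_real (q ^ k) * odd_part f (x * q ^ k)))"
  shows "odd_sum f (- x) = - odd_sum f x"
proof -
  have "odd_part f (- y) = - odd_part f y" for y by (simp add: odd_part_def field_simps)
  then show ?thesis unfolding odd_sum_def by (subst suminf_minus[OF assms, symmetric]) simp
qed

text \<open>All nodes \<open>x q^k\<close> and their negatives lie between
  \<open>- \<bar>x\<bar>\<close> and \<open>\<bar>x\<bar>\<close>, where \<open>f\<close> and
  \<open>dq q f\<close> share a bound.\<close>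

lemma V_op_Eq_space:
  assumes "f \<in> Eq_space q" "x \<in> Rq q"
  shows "summable (\<lambda>k. of_real (w k * q ^ k) * even_part f (x * q ^ k))"
    and "summable (\<lambda>k. of_real (w k * q ^ k) * (of_real (q ^ k) * odd_part f (x * q ^ k)))"
    and "V_op \<alpha> q f x = of_real K * (even_sum f x + odd_sum f x)"
    and "V_op \<alpha> q (dq q f) x = of_real K * (even_sum (dq q f) x + odd_sum (dq q f) x)"
proof -
  obtain B where B: "\<And>y. y \<in> Rq q \<Longrightarrow> \<bar>y\<bar> \<le> \<bar>x\<bar> \<Longrightarrow> cmod (f y) \<le> B"
      "\<And>y. y \<in> Rq q \<Longrightarrow> \<bar>y\<bar> \<le> \<bar>x\<bar> \<Longrightarrow> cmod (dq q f y) \<le> B"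
    using Eq_space_bounded[OF assms(1), of "\<bar>x\<bar>"] by (metis abs_ge_zero)
  have le: "\<bar>x * q ^ k\<bar> \<le> \<bar>x\<bar>" for k
    using q_pos q_less_one by (simp add: abs_mult mult_left_le power_le_one)
  have R: "x * q ^ k \<in> Rq q" "- (x * q ^ k) \<in> Rq q" for k
    using assms(2) by (auto intro: Rq_q Rq_minus)
  have b1: "cmod (f (x * q ^ k)) \<le> B" "cmod (f (- (x * q ^ k))) \<le> B" for k
    using B(1) R[of k] le[of k] by auto
  have b2: "cmod (dq q f (x * q ^ k)) \<le> B" "cmod (dq q f (- (x * q ^ k))) \<le> B" for k
    using B(2) R[of k] le[of k] by auto
  show "summable (\<lambda>k. of_real (w k * q ^ k) * even_part f (x * q ^ k))"
    "summable (\<lambda>k. of_real (w k * q ^ k) * (of_real (q ^ k) * odd_part f (x * q ^ k)))"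
    "V_op \<alpha> q f x = of_real K * (even_sum f x + odd_sum f x)"
    using V_op_even_odd[OF b1] unfolding even_sum_def odd_sum_def by blast+
  show "V_op \<alpha> q (dq q f) x = of_real K * (even_sum (dq q f) x + odd_sum (dq q f) x)"
    using V_op_even_odd(3)[OF b2] unfolding even_sum_def odd_sum_def .
qed

text \<open>\<open>H_op\<close> multiplies the odd part by \<open>b\<close>, which gives
  \<open>b (O(x) - O(qx))\<close> inside the derivative, \<open>O\<close> being
  \<open>odd_sum f\<close>. The reflection term adds \<open>(1 - b) O(x)\<close>, restoring the
  coefficient 1 at \<open>x\<close> while \<open>b\<close> remains at \<open>qx\<close>.\<close>

lemma qDunkl_V_op:
  assumes f: "f \<in> Eq_space q" and x: "x \<in> Rq q"
  shows "qDunkl \<alpha> q (V_op \<alpha> q f) x = of_real K *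
    (even_sum f (inverse q * x) - even_sum f x + (odd_sum f x - of_real b * odd_sum f (q * x)))
      / of_real ((1 - q) * x)"
proof -
  have minus: "odd_sum f (- y) = - odd_sum f y" if "y \<in> Rq q" for y
    using odd_sum_minus V_op_Eq_space(2)[OF f that] by blast
  have V: "V_op \<alpha> q f y = of_real K * (even_sum f y + odd_sum f y)"
    "V_op \<alpha> q f (- y) = of_real K * (even_sum f y - odd_sum f y)" if "y \<in> Rq q" for y
    using V_op_Eq_space(3)[OF f] that Rq_minus[OF that] minus[OF that] by (auto simp: even_sum_minus)
  have H: "H_op \<alpha> q (V_op \<alpha> q f) y = of_real K * (even_sum f y + of_real b * odd_sum f y)"
    if "y \<in> Rq q" for y
  proof -
    have "(k * (e + o') + k * (e - o')) / 2 + c * ((k * (e + o') - k * (e - o')) / 2) = k * (e + c * o')"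
      for k e o' c :: complex by (simp add: field_simps)
    then show ?thesis unfolding H_op_def even_part_def odd_part_def V[OF that] .
  qed
  have H': "H_op \<alpha> q (V_op \<alpha> q f) (- y) = of_real K * (even_sum f y - of_real b * odd_sum f y)"
    if "y \<in> Rq q" for y
    using H[OF Rq_minus[OF that]] minus[OF that] by (simp add: even_sum_minus)
  have x0: "x \<noteq> 0" using x zero_notin_Rq by auto
  \<comment> \<open>The indices 1 and 2 stand for the points \<open>x/q\<close> and
    \<open>qx\<close>, and \<open>c\<close>, \<open>s\<close>, \<open>t\<close> for
    \<open>b\<close>, \<open>1 - q\<close>, \<open>x\<close>.\<close>
  have alg: "(k * (e1 + c * o1) + k * (e1 - c * o1) - k * (e2 + c * o2) + k * (e2 - c * o2) - 2 * (k * (e - c * o')))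
        / (2 * s * t) + (1 - c) / s * ((k * (e + o') - k * (e - o')) / (2 * t))
      = k * (e1 - e + (o' - c * o2)) / (s * t)"
    if "s \<noteq> 0" "t \<noteq> 0" for k e1 o1 c e2 o2 e o' s t :: complex
    using that by (simp add: divide_simps) (simp add: algebra_simps)
  show ?thesis
    unfolding qDunkl_def dq_def H[OF Rq_q(2)[OF x]] H'[OF Rq_q(2)[OF x]] H[OF Rq_q(1)[OF x]]
      H'[OF Rq_q(1)[OF x]] H'[OF x] V[OF x] qbracket_def
    using alg[of "of_real (1 - q)" "of_real x"] x0 q_less_one by simp
qed

text \<open>The identity holds term by term: the extra \<open>q^k\<close> in \<open>odd_sum\<close>
  cancels the \<open>q^k\<close> in the denominator of the derivative at
  \<open>x q^k\<close>.\<close>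

lemma odd_sum_dq:
  assumes f: "f \<in> Eq_space q" and x: "x \<in> Rq q"
  shows "odd_sum (dq q f) x = (even_sum f (inverse q * x) - even_sum f x) / of_real ((1 - q) * x)"
proof -
  have "odd_sum (dq q f) x = (\<Sum>k. (of_real (w k * q ^ k) * even_part f (inverse q * x * q ^ k)
      - of_real (w k * q ^ k) * even_part f (x * q ^ k)) / of_real ((1 - q) * x))"
    unfolding odd_sum_def
  proof (intro suminf_cong)
    fix k
    have alg: "u * (t * (g / (s * (y * t)))) = u * g / (s * y)" if "t \<noteq> 0" for u t g s y :: complex
      using that by simp
    show "of_real (w k * q ^ k) * (of_real (q ^ k) * odd_part (dq q f) (x * q ^ k))
      = (of_real (w k * q ^ k) * even_part f (inverse q * x * q ^ k)
        - of_real (w k * q ^ k) * even_part f (x * q ^ k)) / of_real ((1 - q) * x)"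
      unfolding odd_part_dq of_real_mult[of "1 - q"] of_real_mult[of x]
      by (subst alg) (use q_pos in \<open>auto simp: right_diff_distrib mult.assoc\<close>)
  qed
  also have "\<dots> = (even_sum f (inverse q * x) - even_sum f x) / of_real ((1 - q) * x)"
    unfolding even_sum_def
    by (intro sums_unique[symmetric] sums_divide sums_diff summable_sums V_op_Eq_space(1)[OF f] Rq_q x)
  finally show ?thesis .
qed

text \<open>Summation by parts: with \<open>u\<^sub>k = w\<^sub>k (1 - q\<^bsup>2k\<^esup>) f\<^sub>o(x q\<^sup>k)\<close> the recurrence turns the difference of the
  \<open>k\<close>-th terms into \<open>u\<^sub>k - u\<^bsub>k+1\<^esub>\<close>; both boundary terms vanish, as \<open>u\<^sub>0 = 0\<close> and \<open>f\<^sub>o\<close> tends to \<open>0\<close> at \<open>0\<close>.\<close>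

lemma even_sum_dq:
  assumes f: "f \<in> Eq_space q" and x: "x \<in> Rq q"
  shows "even_sum (dq q f) x = (odd_sum f x - of_real b * odd_sum f (q * x)) / of_real ((1 - q) * x)"
proof -
  define g where "g k = odd_part f (x * q ^ k)" for k
  define u where "u k = complex_of_real (w k * (1 - q ^ (2 * k))) * g k" for k
  have x0: "x \<noteq> 0" using x zero_notin_Rq by auto
  \<comment> \<open>The limit clause at \<open>n = 0\<close> gives the same limit along
    \<open>x q^k\<close> and \<open>- x q^k\<close>, so the odd part tends to 0.\<close>
  have "\<forall>n. \<exists>L. ((dq q ^^ n) f \<longlongrightarrow> L) (at 0 within Rq q)"
    using f unfolding Eq_space_def by blast
  from this[rule_format, of 0] obtain L where L: "(f \<longlongrightarrow> L) (at 0 within Rq q)" by auto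
  have "(\<lambda>k. f (x * q ^ k)) \<longlonglongrightarrow> L"
    by (rule tendsto_compose_within[OF L LIMSEQ_mult_q_power]) (use x Rq_q zero_notin_Rq in auto)
  moreover have "(\<lambda>k. f (- x * q ^ k)) \<longlonglongrightarrow> L"
    by (rule tendsto_compose_within[OF L LIMSEQ_mult_q_power])
      (use Rq_minus[OF x] Rq_q(3)[of "- x"] zero_notin_Rq in auto)
  ultimately have "(\<lambda>k. (f (x * q ^ k) - f (- x * q ^ k)) / 2) \<longlonglongrightarrow> (L - L) / 2"
    by (intro tendsto_intros) auto
  then have g0: "g \<longlonglongrightarrow> 0" by (simp add: g_def[abs_def] odd_part_def)
  have "\<bar>w k * (1 - q ^ (2 * k))\<bar> \<le> 1 / qpoch_inf b (q\<^sup>2)" for k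
  proof -
    have "w k * (1 - q ^ (2 * k)) \<le> w k"
      using w_pos[of k] q_pos by (intro mult_left_le) auto
    moreover have "0 \<le> w k * (1 - q ^ (2 * k))"
      using w_pos[of k] q_pos q_less_one by (intro mult_nonneg_nonneg) (auto simp: power_le_one)
    ultimately show ?thesis using w_le[of k] by simp
  qed
  then have "norm (u k) \<le> 1 / qpoch_inf b (q\<^sup>2) * norm (g k)" for k
    unfolding u_def norm_mult norm_of_real by (rule mult_right_mono) simp
  then have "\<forall>\<^sub>F k in sequentially. norm (u k) \<le> 1 / qpoch_inf b (q\<^sup>2) * norm (g k)"
    by (rule always_eventually[OF allI])
  then have "u \<longlonglongrightarrow> 0"
    by (rule Lim_null_comparison) (intro tendsto_mult_right_zero tendsto_norm_zero g0)
  then have T: "(\<lambda>k. u k - u (Suc k)) sums 0"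
    using telescope_sums'[of u 0] by (simp add: u_def)
  have S: "(\<lambda>k. of_real (w k * q ^ k) * (of_real (q ^ k) * odd_part f (y * q ^ k))) sums odd_sum f y"
    if "y \<in> Rq q" for y
    unfolding odd_sum_def using V_op_Eq_space(2)[OF f that] by (rule summable_sums)
  \<comment> \<open>Adding a telescoping series of sum 0 leaves the value unchanged. By
    \<open>w_rec\<close> it reduces the \<open>k\<close>-th term to
    \<open>w k * (g k - g (Suc k))\<close>, the shape of the even part of the derivative.\<close>
  have "(\<lambda>k. (u k - u (Suc k)) + (of_real (w k * q ^ k) * (of_real (q ^ k) * odd_part f (x * q ^ k))
      - of_real b * (of_real (w k * q ^ k) * (of_real (q ^ k) * odd_part f (q * x * q ^ k)))))
      sums (0 + (odd_sum f x - of_real b * odd_sum f (q * x)))"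
    by (intro sums_add sums_diff sums_mult T S x Rq_q)
  moreover have "(u k - u (Suc k)) + (of_real (w k * q ^ k) * (of_real (q ^ k) * odd_part f (x * q ^ k))
      - of_real b * (of_real (w k * q ^ k) * (of_real (q ^ k) * odd_part f (q * x * q ^ k))))
      = of_real (w k) * (g k - g (Suc k))" for k
  proof -
    have "q * x * q ^ k = x * q ^ Suc k" by simp
    moreover have "q ^ (2 * k) = q ^ k * q ^ k" by (simp add: mult_2 power_add)
    ultimately show ?thesis
      unfolding u_def w_rec g_def by (simp only:) (simp add: algebra_simps)
  qed
  ultimately have "(\<lambda>k. of_real (w k) * (g k - g (Suc k)) / of_real ((1 - q) * x)) sums
      ((odd_sum f x - of_real b * odd_sum f (q * x)) / of_real ((1 - q) * x))"
    by (simp add: sums_divide)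
  moreover have "of_real (w k * q ^ k) * even_part (dq q f) (x * q ^ k)
      = of_real (w k) * (g k - g (Suc k)) / of_real ((1 - q) * x)" for k
  proof -
    have alg: "u * t * (h / (s * (y * t))) = u * h / (s * y)" if "t \<noteq> 0" for u t h s y :: complex
      using that by simp
    have e: "q * (x * q ^ k) = x * q ^ Suc k" by simp
    show ?thesis
      unfolding even_part_dq e g_def of_real_mult[of "1 - q"] of_real_mult[of x] of_real_mult[of "w k"]
      by (subst alg) (use q_pos in auto)
  qed
  ultimately show ?thesis by (simp add: even_sum_def sums_iff)
qed

lemma V_op_transmutation:
  assumes "f \<in> Eq_space q" "x \<in> Rq q"
  shows "qDunkl \<alpha> q (V_op \<alpha> q f) x = V_op \<alpha> q (dq q f) x"
  unfolding qDunkl_V_op[OF assms] V_op_Eq_space(4)[OF assms] odd_sum_dq[OF assms] even_sum_dq[OF assms]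
  by (simp add: add_divide_distrib[symmetric] add.commute)

text \<open>Tannery's theorem as \<open>x\<close> tends to 0 along the lattice: each summand tends
  to \<open>2 L\<close> times its weight, and near 0 the majorant is \<open>2 B\<close> times the
  weight. The normalisation \<open>K * moment 0 = 1\<close> then returns \<open>L\<close>.\<close>

lemma V_op_tendsto_value0:
  assumes f: "f \<in> Eq_space q"
  shows "(V_op \<alpha> q f \<longlongrightarrow> value0 q f) (at 0 within Rq q)"
proof -
  have "\<forall>n. \<exists>L. ((dq q ^^ n) f \<longlongrightarrow> L) (at 0 within Rq q)"
    using f unfolding Eq_space_def by blast
  from this[rule_format, of 0] obtain L where L: "(f \<longlongrightarrow> L) (at 0 within Rq q)" by auto
  then have value0: "value0 q f = L"
    unfolding value0_def using at_zero_Rq_nontrivial by (intro tendsto_Lim)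
  obtain B where B: "\<And>y. y \<in> Rq q \<Longrightarrow> \<bar>y\<bar> \<le> 1 \<Longrightarrow> cmod (f y) \<le> B"
    using Eq_space_bounded[OF f, of 1] by (metis zero_le_one)
  define a where "a k x = complex_of_real (w k * q ^ k) *
      (of_real (1 + q ^ k) * f (x * q ^ k) + of_real (1 - q ^ k) * f (- (x * q ^ k)))" for k x
  have "((\<lambda>x. \<Sum>k. a k x) \<longlongrightarrow> (\<Sum>k. of_real (w k * q ^ k) * (2 * L))) (at 0 within Rq q)"
  proof (rule tannerys_theorem[THEN conjunct2, THEN conjunct2])
    fix k
    \<comment> \<open>Multiplication by a node maps the lattice into itself and tends to 0 without
      reaching it.\<close>
    have scale: "((\<lambda>x. f (s * x)) \<longlongrightarrow> L) (at 0 within Rq q)" if "s = q ^ k \<or> s = - (q ^ k)" for s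
    proof (rule filterlim_compose[OF L])
      have "\<forall>\<^sub>F x in at 0 within Rq q. s * x \<in> Rq q - {0}"
        unfolding eventually_at_filter
        using that q_pos Rq_q(3)[of _ k] Rq_minus
        by (intro always_eventually) (auto simp: mult.commute)
      moreover have "((\<lambda>x. s * x) \<longlongrightarrow> s * 0) (at 0 within Rq q)"
        by (intro tendsto_intros)
      ultimately show "filterlim ((*) s) (at 0 within Rq q) (at 0 within Rq q)"
        by (simp add: filterlim_at eventually_conj_iff)
    qed
    have "((\<lambda>x. a k x) \<longlongrightarrow> of_real (w k * q ^ k) * (of_real (1 + q ^ k) * L + of_real (1 - q ^ k) * L))
        (at 0 within Rq q)"
      unfolding a_def using scale[of "q ^ k"] scale[of "- (q ^ k)"]
      by (intro tendsto_intros) (auto simp: mult.commute)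
    then show "((\<lambda>x. a k x) \<longlongrightarrow> of_real (w k * q ^ k) * (2 * L)) (at 0 within Rq q)"
      by (simp add: algebra_simps)
  next
    have bound: "norm (a k x) \<le> w k * q ^ k * (2 * B)" if "x \<in> Rq q" "\<bar>x\<bar> \<le> 1" for k x
    proof -
      have "\<bar>x * q ^ k\<bar> \<le> 1"
        using that(2) q_pos q_less_one by (simp add: abs_mult mult_le_one power_le_one)
      then have fb: "cmod (f (x * q ^ k)) \<le> B" "cmod (f (- (x * q ^ k))) \<le> B"
        using B that(1) Rq_q(3) Rq_minus by auto
      have q1: "0 \<le> q ^ k" "q ^ k \<le> 1" using q_pos q_less_one by (auto simp: power_le_one)
      have "cmod (of_real (1 + q ^ k) * f (x * q ^ k)) \<le> (1 + q ^ k) * B"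
        using fb(1) q1 by (simp only: norm_mult norm_of_real) (simp add: mult_left_mono)
      moreover have "cmod (of_real (1 - q ^ k) * f (- (x * q ^ k))) \<le> (1 - q ^ k) * B"
        using fb(2) q1 by (simp only: norm_mult norm_of_real) (simp add: mult_left_mono)
      ultimately have "cmod (of_real (1 + q ^ k) * f (x * q ^ k) + of_real (1 - q ^ k) * f (- (x * q ^ k)))
          \<le> 2 * B"
        by (intro norm_triangle_le) (simp add: algebra_simps)
      moreover have "0 \<le> w k * q ^ k" using w_pos[of k] q_pos by simp
      ultimately show ?thesis
        unfolding a_def norm_mult[of "of_real (w k * q ^ k)"] norm_of_real
        by (simp add: mult_left_mono)
    qed
    have "\<forall>\<^sub>F x in at 0 within Rq q. x \<in> Rq q \<and> \<bar>x\<bar> \<le> 1"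
      unfolding eventually_at by (intro exI[of _ 1]) auto
    \<comment> \<open>The bound holds for every \<open>k\<close>, so only \<open>x\<close> is
      restricted.\<close>
    then show "\<forall>\<^sub>F (k, x) in sequentially \<times>\<^sub>F (at 0 within Rq q). norm (a k x) \<le> w k * q ^ k * (2 * B)"
      unfolding eventually_prod_filter
      by (intro exI[of _ "\<lambda>_. True"] exI[of _ "\<lambda>x. x \<in> Rq q \<and> \<bar>x\<bar> \<le> 1"]) (auto intro: bound)
    show "summable (\<lambda>k. w k * q ^ k * (2 * B))" using summable_weight by (rule summable_mult2)
  qed (rule at_zero_Rq_nontrivial)
  then have "((\<lambda>x. of_real (K / 2) * (\<Sum>k. a k x)) \<longlongrightarrow>
      of_real (K / 2) * (\<Sum>k. of_real (w k * q ^ k) * (2 * L))) (at 0 within Rq q)"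
    by (rule tendsto_mult_left)
  moreover have "of_real (K / 2) * (\<Sum>k. of_real (w k * q ^ k) * (2 * L)) = L"
  proof -
    have "(\<Sum>k. of_real (w k * q ^ k) * (2 * L)) = of_real (moment 0) * (2 * L)"
      using suminf_mult2[OF summable_of_real[OF summable_weight], of "2 * L"]
        suminf_of_real[OF summable_weight, where 'a = complex] by (simp add: moment_def)
    then have "of_real (K / 2) * (\<Sum>k. of_real (w k * q ^ k) * (2 * L)) = of_real (K * moment 0) * L"
      by simp
    then show ?thesis unfolding C_const_moment_0 by simp
  qed
  moreover have "V_op \<alpha> q f = (\<lambda>x. of_real (K / 2) * (\<Sum>k. a k x))"
    unfolding a_def by (rule ext) (rule V_op_eq)
  ultimately show ?thesis unfolding value0 by simp
qed

end

theorem theorem5: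
  fixes q \<alpha> :: real
  assumes "0 < q" and "q < 1"
    and "\<exists>m::int. even m \<and> ln (1 - q) / ln q = of_int m"
    and "\<alpha> > - 1 / 2"
  shows "(\<forall>\<mu>\<in>Rq q. \<forall>x\<in>Rq q.
            V_op \<alpha> q (\<lambda>y. qexp q (- \<i> * of_real \<mu> * of_real y)) x = psi \<alpha> q (- \<mu>) x)
       \<and> (\<forall>f\<in>Eq_space q.
            (\<forall>x\<in>Rq q. qDunkl \<alpha> q (V_op \<alpha> q f) x = V_op \<alpha> q (dq q f) x)
            \<and> (V_op \<alpha> q f \<longlongrightarrow> value0 q f) (at 0 within Rq q))"
proof -
  interpret q_dunkl q \<alpha> using assms(1,2,4) by unfold_locales
  show ?thesis
    \<comment> \<open>Points of the lattice are non-zero, hence so is the product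
      \<open>\<mu> * x\<close> required by \<open>V_op_qexp\<close>.\<close>
    using V_op_qexp V_op_transmutation V_op_tendsto_value0 zero_notin_Rq
    by (metis mult_eq_0_iff)
qed

end
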